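(* Let $(\Omega,\mathcal F,P)$ be a probability space with $L_2(\Omega,\mathcal F,P)$ separable, let $\Lambda$ be the lattice of all sub-$\sigma$-fields of $\mathcal F$ (each containing all null sets), and let $B\subset\Lambda$ be a noise-type Boolean algebra. Denote by $C$ its noise-type completion, and by $\tilde B$ the least monotonically closed subset of $\Lambda$ containing $B$. Then an arbitrary $\sigma$-field $\mathcal E\in\Lambda$ belongs to $C$ if and only if it satisfies the following two conditions: (a) $\mathcal E\in\tilde B$; (b) $\mathcal E$ has a complement $\mathcal E'$ in $\tilde B$; that is, there is $\mathcal E'\in\tilde B$ such that $\mathcal E\cap\mathcal E'$ is the trivial $\sigma$-field and $\mathcal E\vee\mathcal E'=\mathcal F$. Moreover, for $\mathcal E$ satisfying (a) and (b), such $\mathcal E'$ is necessarily unique.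
   Context: Every sub-$\sigma$-field of $\mathcal F$ is assumed to contain all null sets of $\mathcal F$. $\Lambda$ is ordered by inclusion; it is a lattice with $\mathcal E_1\wedge\mathcal E_2=\mathcal E_1\cap\mathcal E_2$ and $\mathcal E_1\vee\mathcal E_2$ the least $\sigma$-field containing both $\mathcal E_1$ and $\mathcal E_2$. The trivial $\sigma$-field consists of the null sets and their complements only. Two $\sigma$-fields $\mathcal E_1,\mathcal E_2$ are independent if $P(X\cap Y)=P(X)P(Y)$ for all $X\in\mathcal E_1$, $Y\in\mathcal E_2$. A noise-type Boolean algebra is a sublattice $B$ of $\Lambda$, containing the trivial $\sigma$-field and the whole $\mathcal F$, such that $B$ (with the induced lattice operations) is a Boolean algebra (a distributive lattice in which every element has a complement in $B$), and any two $\sigma$-fields of $B$ are independent whenever their intersection is the trivial $\sigma$-field. A subset $Z\subset\Lambda$ is monotonically closed if $Z$ contains $\bigcap_n\mathcal E_n$ for every decreasing sequence of $\sigma$-fields $\mathcal E_n\in Z$, and $Z$ contains $\bigvee_n\mathcal E_n$ (the least $\sigma$-field containing all $\mathcal E_n$) for every increasing sequence of $\sigma$-fields $\mathcal E_n\in Z$. For noise-type Boolean algebras $B_1\subset B_2\subset\Lambda$, $B_1$ is monotonically dense in $B_2$ if every monotonically closed subset of $\Lambda$ containing $B_1$ contains also $B_2$. The noise-type completion of a noise-type Boolean algebra $B\subset\Lambda$ is the greatest (with respect to inclusion) among all noise-type Boolean algebras $C\subset\Lambda$ such that $B\subset C$ and $B$ is monotonically dense in $C$; it always exists. *)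

theory Defs
  imports "HOL-Probability.Probability"
begin

text \<open>
  A sub-\<open>\<sigma>\<close>-field of a measure space \<open>M\<close> is represented by its collection of events, so that
  inclusion and equality of \<open>\<sigma>\<close>-fields are those of sets, and the meet is the intersection.
\<close>

definition sub_sigma_fields :: "'a measure \<Rightarrow> 'a set set set" where
  "sub_sigma_fields M =
     {E. sigma_algebra (space M) E \<and> E \<subseteq> sets M \<and> null_sets M \<subseteq> E}"

definition sigma_join :: "'a measure \<Rightarrow> 'a set set \<Rightarrow> 'a set set \<Rightarrow> 'a set set" where
  "sigma_join M E1 E2 = sigma_sets (space M) (E1 \<union> E2)"

definition trivial_field :: "'a measure \<Rightarrow> 'a set set" where
  "trivial_field M = null_sets M \<union> {space M - N | N. N \<in> null_sets M}"

definition complementary_fields :: "'a measure \<Rightarrow> 'a set set \<Rightarrow> 'a set set \<Rightarrow> bool" where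
  "complementary_fields M E E' \<longleftrightarrow> E \<inter> E' = trivial_field M \<and> sigma_join M E E' = sets M"

definition noise_type_BA :: "'a measure \<Rightarrow> 'a set set set \<Rightarrow> bool" where
  "noise_type_BA M B \<longleftrightarrow>
     B \<subseteq> sub_sigma_fields M \<and>
     trivial_field M \<in> B \<and> sets M \<in> B \<and>
     (\<forall>E1\<in>B. \<forall>E2\<in>B. E1 \<inter> E2 \<in> B \<and> sigma_join M E1 E2 \<in> B) \<and>
     (\<forall>E1\<in>B. \<forall>E2\<in>B. \<forall>E3\<in>B.
        E1 \<inter> sigma_join M E2 E3 = sigma_join M (E1 \<inter> E2) (E1 \<inter> E3)) \<and>
     (\<forall>E\<in>B. \<exists>E'\<in>B. complementary_fields M E E') \<and>
     (\<forall>E1\<in>B. \<forall>E2\<in>B. E1 \<inter> E2 = trivial_field M \<longrightarrow> prob_space.indep_set M E1 E2)"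

definition mono_closed :: "'a measure \<Rightarrow> 'a set set set \<Rightarrow> bool" where
  "mono_closed M Z \<longleftrightarrow>
     Z \<subseteq> sub_sigma_fields M \<and>
     (\<forall>E :: nat \<Rightarrow> 'a set set. range E \<subseteq> Z \<and> decseq E \<longrightarrow> (\<Inter>n. E n) \<in> Z) \<and>
     (\<forall>E :: nat \<Rightarrow> 'a set set. range E \<subseteq> Z \<and> incseq E \<longrightarrow>
        sigma_sets (space M) (\<Union>n. E n) \<in> Z)"

definition mono_dense :: "'a measure \<Rightarrow> 'a set set set \<Rightarrow> 'a set set set \<Rightarrow> bool" where
  "mono_dense M B1 B2 \<longleftrightarrow> (\<forall>Z. mono_closed M Z \<and> B1 \<subseteq> Z \<longrightarrow> B2 \<subseteq> Z)"

definition noise_completion :: "'a measure \<Rightarrow> 'a set set set \<Rightarrow> 'a set set set" where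
  "noise_completion M B = (GREATEST C. noise_type_BA M C \<and> B \<subseteq> C \<and> mono_dense M B C)"

definition mono_closure :: "'a measure \<Rightarrow> 'a set set set \<Rightarrow> 'a set set set" where
  "mono_closure M B = mono_closed M hull B"

text \<open>The intersection defining the hull is not vacuous, and it is the least element:\<close>

lemma mono_closed_sub_sigma_fields: "mono_closed M (sub_sigma_fields M)"
proof -
  have "(\<Inter>n. E n) \<in> sub_sigma_fields M"
    if E: "range E \<subseteq> sub_sigma_fields M" for E :: "nat \<Rightarrow> 'a set set"
  proof -
    have "\<And>n. sigma_algebra (space M) (E n)" "\<And>n. E n \<subseteq> sets M" "\<And>n. null_sets M \<subseteq> E n"
      using E by (auto simp: sub_sigma_fields_def image_subset_iff)
    then show ?thesis
      unfolding sub_sigma_fields_def sigma_algebra_iff2 by (simp add: subset_iff) blast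
  qed
  moreover have "sigma_sets (space M) (\<Union>n. E n) \<in> sub_sigma_fields M"
    if E: "range E \<subseteq> sub_sigma_fields M" for E :: "nat \<Rightarrow> 'a set set"
  proof -
    have sub: "(\<Union>n. E n) \<subseteq> sets M" and null: "null_sets M \<subseteq> E 0"
      using E by (auto simp: sub_sigma_fields_def image_subset_iff)
    have "(\<Union>n. E n) \<subseteq> Pow (space M)"
      using sub sets.space_closed by blast
    moreover have "null_sets M \<subseteq> sigma_sets (space M) (\<Union>n. E n)"
      using null by (auto intro: sigma_sets.Basic)
    ultimately show ?thesis
      using sub by (simp add: sub_sigma_fields_def sigma_algebra_sigma_sets sets.sigma_sets_subset)
  qed
  ultimately show ?thesis
    unfolding mono_closed_def by blast
qed

lemma mono_closure_least:
  assumes "B \<subseteq> sub_sigma_fields M"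
  shows "mono_closed M (mono_closure M B)" and "B \<subseteq> mono_closure M B"
    and "\<And>Z. mono_closed M Z \<Longrightarrow> B \<subseteq> Z \<Longrightarrow> mono_closure M B \<subseteq> Z"
proof -
  have "mono_closure M B \<subseteq> sub_sigma_fields M"
    unfolding mono_closure_def using assms mono_closed_sub_sigma_fields by (rule hull_minimal)
  moreover have "(\<Inter>n. E n) \<in> mono_closure M B"
    if "range E \<subseteq> mono_closure M B" "decseq E" for E :: "nat \<Rightarrow> 'a set set"
    using that by (auto simp: mono_closure_def hull_def mono_closed_def image_subset_iff)
  moreover have "sigma_sets (space M) (\<Union>n. E n) \<in> mono_closure M B"
    if "range E \<subseteq> mono_closure M B" "incseq E" for E :: "nat \<Rightarrow> 'a set set"
    using that by (auto simp: mono_closure_def hull_def mono_closed_def image_subset_iff)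
  ultimately show "mono_closed M (mono_closure M B)"
    by (simp add: mono_closed_def)
  show "B \<subseteq> mono_closure M B"
    unfolding mono_closure_def by (rule hull_subset)
  show "\<And>Z. mono_closed M Z \<Longrightarrow> B \<subseteq> Z \<Longrightarrow> mono_closure M B \<subseteq> Z"
    unfolding mono_closure_def by (rule hull_minimal)
qed

text \<open>
  Square-integrable functions are not identified when they agree almost everywhere; this does not
  affect separability.
\<close>

definition L2_functions :: "'a measure \<Rightarrow> ('a \<Rightarrow> real) set" where
  "L2_functions M = {f \<in> borel_measurable M. integrable M (\<lambda>x. (f x)\<^sup>2)}"

definition separable_L2 :: "'a measure \<Rightarrow> bool" where
  "separable_L2 M \<longleftrightarrow>
     (\<exists>D. countable D \<and> D \<subseteq> L2_functions M \<and>
       (\<forall>f\<in>L2_functions M. \<forall>\<epsilon>>0. \<exists>g\<in>D. sqrt (\<integral>x. (f x - g x)\<^sup>2 \<partial>M) < \<epsilon>))"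

end

(*
  Call F and G commuting if conditional expectation given F maps indicators of events of G to
  G-measurable functions; this is symmetric, passes to monotone limits in G (no martingale
  convergence is needed), and holds within B, hence within its monotone closure. Commuting fields
  with trivial intersection are independent, and commuting makes increasing joins distribute over
  intersection. For a complementary pair y, y' in the closure, the independence of y and y' gives
  the missing continuity of joins along decreasing sequences,
    INT n. (y v H n) = y v (INT n. H n)   for H n <= y',
  so that x = (x ^ y) v (x ^ y') extends from x in B to all x in the closure. This splitting yields
  the uniqueness of complements and shows that the complemented elements of the closure form a
  noise-type Boolean algebra, which contains every competitor.
*)
theory Submission
  imports Defs
begin

section \<open>Lattice operations on sub-sigma-fields\<close>

lemma sub_sigma_fieldsD:
  assumes "E \<in> sub_sigma_fields M"
  shows "sigma_algebra (space M) E" and "E \<subseteq> sets M" and "null_sets M \<subseteq> E"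
    and "E \<subseteq> Pow (space M)" and "sets (sigma (space M) E) = E"
proof -
  show *: "sigma_algebra (space M) E" and "E \<subseteq> sets M" and "null_sets M \<subseteq> E"
    using assms by (auto simp: sub_sigma_fields_def)
  then show "E \<subseteq> Pow (space M)"
    using sets.space_closed by blast
  show "sets (sigma (space M) E) = E"
    using * by (rule sigma_algebra.sets_measure_of_eq)
qed

lemma measurable_sub_sigma_field_mono:
  assumes "E \<in> sub_sigma_fields M" "F \<in> sub_sigma_fields M" "E \<subseteq> F"
    and "f \<in> measurable (sigma (space M) E) N"
  shows "f \<in> measurable (sigma (space M) F) N"
  using assms(4) sub_sigma_fieldsD(5)[OF assms(1)] sub_sigma_fieldsD(5)[OF assms(2)] assms(3)
  unfolding measurable_def by (auto simp: space_measure_of_conv)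

lemma Inter_sub_sigma_fields:
  assumes "\<And>i. E i \<in> sub_sigma_fields M"
  shows "(\<Inter>i. E i) \<in> sub_sigma_fields M"
proof -
  have "\<And>n. sigma_algebra (space M) (E n)" "\<And>n. E n \<subseteq> sets M" "\<And>n. null_sets M \<subseteq> E n"
    using sub_sigma_fieldsD(1-3)[OF assms] by simp_all
  then show ?thesis
    unfolding sub_sigma_fields_def sigma_algebra_iff2 by (simp add: subset_iff) blast
qed

lemma Int_sub_sigma_fields:
  assumes "E \<in> sub_sigma_fields M" "F \<in> sub_sigma_fields M"
  shows "E \<inter> F \<in> sub_sigma_fields M"
proof -
  \<comment> \<open>The two fields are indexed by the booleans, so that the statement for families
    covers the binary meet.\<close>
  have "(\<Inter>i. case_bool E F i) \<in> sub_sigma_fields M"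
    using assms by (intro Inter_sub_sigma_fields) (auto split: bool.split)
  then show ?thesis
    by (simp add: UNIV_bool Int_commute)
qed

lemma sigma_sets_sub_sigma_fields:
  assumes "G \<subseteq> sets M" "null_sets M \<subseteq> sigma_sets (space M) G"
  shows "sigma_sets (space M) G \<in> sub_sigma_fields M"
proof -
  have "G \<subseteq> Pow (space M)"
    using assms(1) sets.space_closed by blast
  then show ?thesis
    using assms by (simp add: sub_sigma_fields_def sigma_algebra_sigma_sets sets.sigma_sets_subset)
qed

lemma sigma_join_sub_sigma_fields:
  assumes "E \<in> sub_sigma_fields M" "F \<in> sub_sigma_fields M"
  shows "sigma_join M E F \<in> sub_sigma_fields M"
  unfolding sigma_join_def
  by (rule sigma_sets_sub_sigma_fields)
     (use sub_sigma_fieldsD[OF assms(1)] sub_sigma_fieldsD[OF assms(2)] in auto)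

lemma sigma_sets_least:
  assumes "H \<in> sub_sigma_fields M" "G \<subseteq> H"
  shows "sigma_sets (space M) G \<subseteq> H"
  using sigma_algebra.sigma_sets_subset[OF sub_sigma_fieldsD(1)[OF assms(1)] assms(2)] .

lemma sigma_join_upper:
  shows "E \<subseteq> sigma_join M E F" and "F \<subseteq> sigma_join M E F"
  by (auto simp: sigma_join_def)

lemma sigma_join_least:
  "H \<in> sub_sigma_fields M \<Longrightarrow> E \<subseteq> H \<Longrightarrow> F \<subseteq> H \<Longrightarrow> sigma_join M E F \<subseteq> H"
  unfolding sigma_join_def by (rule sigma_sets_least) auto

lemma sigma_join_mono:
  "E \<subseteq> E' \<Longrightarrow> F \<subseteq> F' \<Longrightarrow> sigma_join M E F \<subseteq> sigma_join M E' F'"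
  unfolding sigma_join_def by (rule sigma_sets_mono') auto

lemma sigma_join_commute: "sigma_join M E F = sigma_join M F E"
  by (simp add: sigma_join_def Un_commute)

text \<open>Unlike the union \<open>E \<union> F\<close>, the rectangles are closed under
  intersection, as Dynkin arguments about the join require.\<close>

lemma sigma_join_eq_sigma_sets_Int:
  assumes "E \<in> sub_sigma_fields M" "F \<in> sub_sigma_fields M"
  shows "sigma_join M E F = sigma_sets (space M) {U \<inter> V | U V. U \<in> E \<and> V \<in> F}"
proof
  have *: "space M \<in> E" "space M \<in> F" "E \<subseteq> Pow (space M)" "F \<subseteq> Pow (space M)"
    using sub_sigma_fieldsD(1,4)[OF assms(1)] sub_sigma_fieldsD(1,4)[OF assms(2)]
    by (auto simp: sigma_algebra_iff2)
  have "E \<union> F \<subseteq> {U \<inter> V | U V. U \<in> E \<and> V \<in> F}"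
  proof
    fix A assume "A \<in> E \<union> F"
    then consider "A \<in> E" | "A \<in> F" by blast
    then show "A \<in> {U \<inter> V | U V. U \<in> E \<and> V \<in> F}"
    proof cases
      case 1
      then have "A = A \<inter> space M" using * by auto
      then show ?thesis using 1 * by blast
    next
      case 2
      then have "A = space M \<inter> A" using * by auto
      then show ?thesis using 2 * by blast
    qed
  qed
  then show "sigma_join M E F \<subseteq> sigma_sets (space M) {U \<inter> V | U V. U \<in> E \<and> V \<in> F}"
    unfolding sigma_join_def by (rule sigma_sets_mono')
next
  let ?J = "sigma_join M E F"
  have J: "?J \<in> sub_sigma_fields M"
    using assms by (rule sigma_join_sub_sigma_fields)
  interpret sigma_algebra "space M" ?J
    using J by (rule sub_sigma_fieldsD)
  have "E \<subseteq> ?J" "F \<subseteq> ?J" by (rule sigma_join_upper)+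
  then show "sigma_sets (space M) {U \<inter> V | U V. U \<in> E \<and> V \<in> F} \<subseteq> ?J"
    by (intro sigma_sets_least[OF J]) auto
qed

lemma Int_stable_rectangles:
  assumes "E \<in> sub_sigma_fields M" "F \<in> sub_sigma_fields M"
  shows "Int_stable {U \<inter> V | U V. U \<in> E \<and> V \<in> F}"
proof (rule Int_stableI)
  interpret E: sigma_algebra "space M" E
    using assms(1) by (rule sub_sigma_fieldsD)
  interpret F: sigma_algebra "space M" F
    using assms(2) by (rule sub_sigma_fieldsD)
  fix A B assume "A \<in> {U \<inter> V | U V. U \<in> E \<and> V \<in> F}" "B \<in> {U \<inter> V | U V. U \<in> E \<and> V \<in> F}"
  then obtain U V U' V' where "A = U \<inter> V" "B = U' \<inter> V'" "U \<in> E" "V \<in> F" "U' \<in> E" "V' \<in> F"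
    by blast
  then have "A \<inter> B = (U \<inter> U') \<inter> (V \<inter> V')" "U \<inter> U' \<in> E" "V \<inter> V' \<in> F"
    by auto
  then show "A \<inter> B \<in> {U \<inter> V | U V. U \<in> E \<and> V \<in> F}" by blast
qed

text \<open>Preimages under \<open>f\<close> and \<open>g\<close> differ only inside a null event,
  and \<open>G\<close> contains every null event. So almost everywhere identities between
  conditional probabilities transfer measurability.\<close>

lemma borel_measurable_AE_sub_sigma_field:
  fixes f g :: "'a \<Rightarrow> ennreal"
  assumes G: "G \<in> sub_sigma_fields M"
    and f: "f \<in> borel_measurable (sigma (space M) G)"
    and g: "g \<in> borel_measurable M"
    and ae: "AE x in M. f x = g x"
  shows "g \<in> borel_measurable (sigma (space M) G)"
proof (rule measurableI)
  note G' = sub_sigma_fieldsD[OF G]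
  interpret G: sigma_algebra "space M" G by (rule G'(1))
  have f': "f \<in> borel_measurable M"
    using f G' unfolding measurable_def by (auto simp: space_measure_of_conv)
  fix A :: "ennreal set" assume A: "A \<in> sets borel"
  let ?N = "{x \<in> space M. f x \<noteq> g x}"
  have N: "?N \<in> null_sets M"
    using ae f' g by (subst (asm) AE_iff_null) auto
  have "f -` A \<inter> space M \<in> G"
    using measurable_sets[OF f A] G' by (simp add: space_measure_of_conv)
  moreover have "?N \<in> G" using N G' by auto
  moreover have "?N \<inter> (g -` A \<inter> space M) \<in> G"
    using null_set_Int2[OF N measurable_sets[OF g A]] G' by (auto simp: Int_commute)
  ultimately have "(f -` A \<inter> space M - ?N) \<union> (?N \<inter> (g -` A \<inter> space M)) \<in> G"
    by auto
  moreover have "g -` A \<inter> space M = (f -` A \<inter> space M - ?N) \<union> (?N \<inter> (g -` A \<inter> space M))"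
    by auto
  ultimately show "g -` A \<inter> space (sigma (space M) G) \<in> sets (sigma (space M) G)"
    using G' by (simp add: space_measure_of_conv)
qed auto

lemma borel_measurable_indicator_sub_sigma_field:
  assumes "F \<in> sub_sigma_fields M" "U \<in> F"
  shows "(indicator U :: 'a \<Rightarrow> ennreal) \<in> borel_measurable (sigma (space M) F)"
  using sub_sigma_fieldsD(5)[OF assms(1)] assms(2) by (intro borel_measurable_indicator) simp

section \<open>Conditional probabilities given a sub-sigma-field\<close>

context prob_space
begin

text \<open>This is a fixed version of the conditional probability, everywhere defined. Values in
  \<open>ennreal\<close> spare integrability conditions.\<close>

definition cprob :: "'a set set \<Rightarrow> 'a set \<Rightarrow> 'a \<Rightarrow> ennreal" where
  "cprob F A = nn_cond_exp M (sigma (space M) F) (indicator A)"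

lemma subalgebra_sub_sigma_field:
  assumes "F \<in> sub_sigma_fields M"
  shows "sigma_finite_subalgebra M (sigma (space M) F)"
proof (rule finite_measure_subalgebra_is_sigma_finite)
  show "finite_measure_subalgebra M (sigma (space M) F)"
    using sub_sigma_fieldsD[OF assms]
    by unfold_locales (auto simp: subalgebra_def space_measure_of_conv)
qed

lemma borel_measurable_cprob: "cprob F A \<in> borel_measurable (sigma (space M) F)"
  and borel_measurable_cprob2 [measurable]: "cprob F A \<in> borel_measurable M"
  by (simp_all add: cprob_def)

lemma nn_integral_cprob:
  assumes "F \<in> sub_sigma_fields M" "h \<in> borel_measurable (sigma (space M) F)" "A \<in> sets M"
  shows "(\<integral>\<^sup>+x. h x * cprob F A x \<partial>M) = (\<integral>\<^sup>+x. h x * indicator A x \<partial>M)"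
proof -
  interpret sigma_finite_subalgebra M "sigma (space M) F"
    using assms(1) by (rule subalgebra_sub_sigma_field)
  show ?thesis
    unfolding cprob_def by (rule nn_cond_exp_intg) (use assms in auto)
qed

lemma cprob_unique:
  assumes F: "F \<in> sub_sigma_fields M" and A: "A \<in> sets M"
    and g: "g \<in> borel_measurable (sigma (space M) F)"
    and eq: "\<And>U. U \<in> F \<Longrightarrow> (\<integral>\<^sup>+x. g x * indicator U x \<partial>M) = emeasure M (A \<inter> U)"
  shows "AE x in M. g x = cprob F A x"
proof -
  interpret sigma_finite_subalgebra M "sigma (space M) F"
    using F by (rule subalgebra_sub_sigma_field)
  show ?thesis
    unfolding cprob_def
  proof (rule nn_cond_exp_charact)
    fix U assume "U \<in> sets (sigma (space M) F)"
    then have U: "U \<in> F" "U \<in> sets M"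
      using sub_sigma_fieldsD[OF F] by auto
    have "(\<integral>\<^sup>+x. indicator A x * indicator U x \<partial>M) = (\<integral>\<^sup>+x. indicator (A \<inter> U) x \<partial>M)"
      by (simp add: indicator_inter_arith)
    also have "\<dots> = emeasure M (A \<inter> U)"
      using A U by simp
    finally show "(\<integral>\<^sup>+x\<in>U. indicator A x \<partial>M) = (\<integral>\<^sup>+x\<in>U. g x \<partial>M)"
      using eq[OF U(1)] by simp
  qed (use A g in auto)
qed

lemma nn_integral_cprob_indicator:
  assumes "F \<in> sub_sigma_fields M" "A \<in> sets M" "U \<in> F"
  shows "(\<integral>\<^sup>+x. cprob F A x * indicator U x \<partial>M) = emeasure M (A \<inter> U)"
proof -
  have U: "U \<in> sets M" "(indicator U :: _ \<Rightarrow> ennreal) \<in> borel_measurable (sigma (space M) F)"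
    using sub_sigma_fieldsD(2)[OF assms(1)] assms
    by (auto intro: borel_measurable_indicator_sub_sigma_field)
  have "(\<integral>\<^sup>+x. cprob F A x * indicator U x \<partial>M) = (\<integral>\<^sup>+x. indicator U x * indicator A x \<partial>M)"
    using nn_integral_cprob[OF assms(1) U(2) assms(2)] by (simp add: mult.commute)
  also have "\<dots> = (\<integral>\<^sup>+x. indicator (A \<inter> U) x \<partial>M)"
    by (simp add: indicator_inter_arith mult.commute)
  finally show ?thesis using U assms by simp
qed

lemma cprob_self:
  assumes "F \<in> sub_sigma_fields M" "A \<in> F"
  shows "AE x in M. indicator A x = cprob F A x"
proof (rule cprob_unique[OF assms(1)])
  have F: "F \<subseteq> sets M" using sub_sigma_fieldsD[OF assms(1)] by auto
  then show "A \<in> sets M" using assms by auto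
  show "(indicator A :: _ \<Rightarrow> ennreal) \<in> borel_measurable (sigma (space M) F)"
    using assms by (rule borel_measurable_indicator_sub_sigma_field)
  fix U assume "U \<in> F"
  then have "A \<inter> U \<in> sets M" using F assms by auto
  then show "(\<integral>\<^sup>+ x. indicator A x * indicator U x \<partial>M) = emeasure M (A \<inter> U)"
    by (simp flip: indicator_inter_arith)
qed

text \<open>For \<open>A \<in> F\<close> the conditional probability is the indicator of
  \<open>A\<close> up to a null set. This turns measurability of functions back into membership of
  events.\<close>

lemma in_sub_sigma_fieldI:
  assumes "F \<in> sub_sigma_fields M" "G \<in> sub_sigma_fields M" "A \<in> F"
    and "cprob F A \<in> borel_measurable (sigma (space M) G)"
  shows "A \<in> G"
proof -
  have A: "A \<in> sets M" using sub_sigma_fieldsD[OF assms(1)] assms(3) by auto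
  have "(indicator A :: _ \<Rightarrow> ennreal) \<in> borel_measurable (sigma (space M) G)"
    by (rule borel_measurable_AE_sub_sigma_field[OF assms(2,4)])
       (use A cprob_self[OF assms(1,3)] in \<open>auto elim: AE_mp\<close>)
  then have "indicator A -` {1::ennreal} \<inter> space M \<in> G"
    using measurable_sets[of "indicator A" "sigma (space M) G" "borel :: ennreal measure" "{1}"]
      sub_sigma_fieldsD[OF assms(2)] by (auto simp: space_measure_of_conv)
  moreover have "indicator A -` {1::ennreal} \<inter> space M = A"
    using sets.sets_into_space[OF A] by (auto simp: indicator_def)
  ultimately show ?thesis by simp
qed

text \<open>Dynkin argument: complements act by \<open>1 - cprob F A\<close> and countable disjoint
  unions by sums, and both operations preserve measurability with respect to
  \<open>G\<close>.\<close>

lemma cprob_measurable_sigma_sets: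
  assumes F: "F \<in> sub_sigma_fields M" and G: "G \<in> sub_sigma_fields M"
    and P: "Int_stable P" "P \<subseteq> sets M"
    and gen: "\<And>A. A \<in> P \<Longrightarrow> cprob F A \<in> borel_measurable (sigma (space M) G)"
    and A: "A \<in> sigma_sets (space M) P"
  shows "cprob F A \<in> borel_measurable (sigma (space M) G)"
proof -
  interpret S: sigma_finite_subalgebra M "sigma (space M) F"
    using F by (rule subalgebra_sub_sigma_field)
  have P': "P \<subseteq> Pow (space M)" using P(2) sets.space_closed by blast
  have ev: "A \<in> sets M" if "A \<in> sigma_sets (space M) P" for A
    using that P(2) sets.sigma_sets_subset by blast
  show ?thesis
  proof (rule sigma_sets_induct_disjoint[OF P(1) P' A])
    show "cprob F A \<in> borel_measurable (sigma (space M) G)" if "A \<in> P" for A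
      using gen that .
    show "cprob F {} \<in> borel_measurable (sigma (space M) G)"
    proof (rule borel_measurable_AE_sub_sigma_field[OF G])
      show "AE x in M. 0 = cprob F {} x"
        by (rule cprob_unique[OF F]) auto
    qed auto
    show "cprob F (space M - A) \<in> borel_measurable (sigma (space M) G)"
      if A: "A \<in> sigma_sets (space M) P"
        and m: "cprob F A \<in> borel_measurable (sigma (space M) G)" for A
    proof (rule borel_measurable_AE_sub_sigma_field[OF G])
      have A': "A \<in> sets M" using ev A .
      \<comment> \<open>This bound by 1 makes \<open>cprob F A x\<close> finite, so that subtraction
        in \<open>ennreal\<close> really undoes addition.\<close>
      have "AE x in M. cprob F A x \<le> cprob F (space M) x"
        unfolding cprob_def using A' sets.sets_into_space[OF A']
        by (intro S.nn_cond_exp_mono) (auto simp: indicator_def)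
      moreover have "AE x in M. indicator (space M) x = cprob F (space M) x"
        by (rule cprob_self[OF F])
           (use sub_sigma_fieldsD(1)[OF F] in \<open>auto simp: sigma_algebra_iff2\<close>)
      moreover have "AE x in M. cprob F A x + cprob F (space M - A) x
          = nn_cond_exp M (sigma (space M) F) (\<lambda>x. indicator A x + indicator (space M - A) x) x"
        unfolding cprob_def by (rule S.nn_cond_exp_sum) (use A' in auto)
      moreover have "AE x in M. nn_cond_exp M (sigma (space M) F)
          (\<lambda>x. indicator A x + indicator (space M - A) x) x = cprob F (space M) x"
        unfolding cprob_def
        by (rule S.nn_cond_exp_cong) (use A' in \<open>auto simp: indicator_def\<close>)
      moreover have "AE x in M. x \<in> space M" by (rule AE_space)
      ultimately show "AE x in M. 1 - cprob F A x = cprob F (space M - A) x"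
      proof eventually_elim
        case (elim x)
        then have "cprob F A x + cprob F (space M - A) x = 1" "cprob F A x \<le> 1"
          by auto
        then show ?case
          by (metis ennreal_add_diff_cancel_left ennreal_one_neq_top neq_top_trans)
      qed
      show "(\<lambda>x. 1 - cprob F A x) \<in> borel_measurable (sigma (space M) G)"
        using m by measurable
    qed auto
    show "cprob F (\<Union>i. A i) \<in> borel_measurable (sigma (space M) G)"
      if d: "disjoint_family A" and r: "range A \<subseteq> sigma_sets (space M) P"
        and m: "\<And>i. cprob F (A i) \<in> borel_measurable (sigma (space M) G)" for A :: "nat \<Rightarrow> 'a set"
    proof (rule borel_measurable_AE_sub_sigma_field[OF G])
      have A': "A i \<in> sets M" for i using ev r by auto
      show "AE x in M. (\<Sum>i. cprob F (A i) x) = cprob F (\<Union>i. A i) x"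
      proof (rule cprob_unique[OF F])
        show "(\<lambda>x. \<Sum>i. cprob F (A i) x) \<in> borel_measurable (sigma (space M) F)"
          using borel_measurable_cprob by measurable
        fix U assume U: "U \<in> F"
        then have U': "U \<in> sets M" using sub_sigma_fieldsD[OF F] by auto
        have "(\<integral>\<^sup>+x. (\<Sum>i. cprob F (A i) x) * indicator U x \<partial>M)
            = (\<integral>\<^sup>+x. (\<Sum>i. cprob F (A i) x * indicator U x) \<partial>M)"
          by simp
        also have "\<dots> = (\<Sum>i. \<integral>\<^sup>+x. cprob F (A i) x * indicator U x \<partial>M)"
          using U' by (intro nn_integral_suminf) auto
        also have "\<dots> = (\<Sum>i. emeasure M (A i \<inter> U))"
          using nn_integral_cprob_indicator[OF F A' U] by simp
        also have "\<dots> = emeasure M (\<Union>i. A i \<inter> U)"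
          using d U' A' by (intro suminf_emeasure) (auto simp: disjoint_family_on_def)
        finally show "(\<integral>\<^sup>+x. (\<Sum>i. cprob F (A i) x) * indicator U x \<partial>M)
            = emeasure M ((\<Union>i. A i) \<inter> U)" by (simp add: Int_UN_distrib2)
      qed (use A' in auto)
      show "(\<lambda>x. \<Sum>i. cprob F (A i) x) \<in> borel_measurable (sigma (space M) G)"
        using m by measurable
    qed auto
  qed
qed

lemma measurable_Inter_sub_sigma_fields:
  assumes "\<And>i. E i \<in> sub_sigma_fields M"
    and "\<And>i. f \<in> measurable (sigma (space M) (E i)) N"
  shows "f \<in> measurable (sigma (space M) (\<Inter>i. E i)) N"
proof (rule measurableI)
  note E = sub_sigma_fieldsD(5)[OF assms(1)] sub_sigma_fieldsD(5)[OF Inter_sub_sigma_fields[of E, OF assms(1)]]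
  show "f x \<in> space N" if "x \<in> space (sigma (space M) (\<Inter>i. E i))" for x
    using that measurable_space[OF assms(2)] by (simp add: space_measure_of_conv)
  show "f -` A \<inter> space (sigma (space M) (\<Inter>i. E i)) \<in> sets (sigma (space M) (\<Inter>i. E i))"
    if "A \<in> sets N" for A
    using measurable_sets[OF assms(2) that] E by (simp add: space_measure_of_conv)
qed

section \<open>Commuting sigma-fields\<close>

text \<open>For members of \<open>sub_sigma_fields M\<close> this says that the conditional
  expectation operators given \<open>F\<close> and \<open>G\<close> commute, their product being the
  one given \<open>F \<inter> G\<close>. The one-sided form is chosen because it passes easily to
  limits in \<open>G\<close>.\<close>

definition commuting_fields :: "'a set set \<Rightarrow> 'a set set \<Rightarrow> bool" where
  "commuting_fields F G \<longleftrightarrow> (\<forall>A\<in>G. cprob F A \<in> borel_measurable (sigma (space M) G))"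

lemma cprob_Int_measurable:
  assumes F: "F \<in> sub_sigma_fields M" and G: "G \<in> sub_sigma_fields M"
    and "commuting_fields F G" "A \<in> G"
  shows "cprob F A \<in> borel_measurable (sigma (space M) (F \<inter> G))"
proof -
  have "cprob F A \<in> borel_measurable (sigma (space M) (\<Inter>i. case_bool F G i))"
    using assms borel_measurable_cprob
    by (intro measurable_Inter_sub_sigma_fields) (auto simp: commuting_fields_def split: bool.split)
  then show ?thesis
    by (simp add: UNIV_bool Int_commute)
qed

text \<open>Self-adjointness of conditional expectation: for \<open>B \<in> F\<close>, the
  conditional probability given \<open>F \<inter> G\<close> turns out to be a version of the one
  given \<open>G\<close>, hence the latter is measurable with respect to \<open>F\<close>.\<close>

lemma commuting_fields_sym:
  assumes F: "F \<in> sub_sigma_fields M" and G: "G \<in> sub_sigma_fields M"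
    and c: "commuting_fields F G"
  shows "commuting_fields G F"
  unfolding commuting_fields_def
proof
  let ?H = "F \<inter> G"
  have H: "?H \<in> sub_sigma_fields M" using F G by (rule Int_sub_sigma_fields)
  have ev: "F \<subseteq> sets M" "G \<subseteq> sets M"
    using sub_sigma_fieldsD(2) F G by blast+
  fix B assume B: "B \<in> F"
  have mG: "cprob ?H B \<in> borel_measurable (sigma (space M) G)"
    using measurable_sub_sigma_field_mono[OF H G _ borel_measurable_cprob] by auto
  have mF: "cprob ?H B \<in> borel_measurable (sigma (space M) F)"
    using measurable_sub_sigma_field_mono[OF H F _ borel_measurable_cprob] by auto
  have "AE x in M. cprob ?H B x = cprob G B x"
  proof (rule cprob_unique[OF G _ mG])
    show "B \<in> sets M" using B ev by auto
    fix A assume A: "A \<in> G"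
    have mA: "cprob F A \<in> borel_measurable (sigma (space M) ?H)"
      using cprob_Int_measurable[OF F G c A] .
    \<comment> \<open>First \<open>A\<close> is conditioned on \<open>F\<close>, the other factor
      being measurable there; then \<open>cprob ?H B\<close> is traded back for \<open>B\<close>,
      because \<open>cprob F A\<close> is measurable with respect to \<open>?H\<close>.\<close>
    have "(\<integral>\<^sup>+x. cprob ?H B x * indicator A x \<partial>M) = (\<integral>\<^sup>+x. cprob ?H B x * cprob F A x \<partial>M)"
      using nn_integral_cprob[OF F mF, of A] A ev by auto
    also have "\<dots> = (\<integral>\<^sup>+x. cprob F A x * indicator B x \<partial>M)"
      using nn_integral_cprob[OF H mA, of B] B ev by (auto simp: mult.commute)
    also have "\<dots> = emeasure M (A \<inter> B)"
      by (rule nn_integral_cprob_indicator[OF F]) (use A B ev in auto)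
    finally show "(\<integral>\<^sup>+x. cprob ?H B x * indicator A x \<partial>M) = emeasure M (B \<inter> A)"
      by (simp add: Int_commute)
  qed
  then show "cprob G B \<in> borel_measurable (sigma (space M) F)"
    by (rule borel_measurable_AE_sub_sigma_field[OF F mF borel_measurable_cprob2])
qed

text \<open>An event of the intersection lies in every \<open>E n\<close>, so the single function
  \<open>cprob F A\<close> is measurable with respect to all of them at once; no limit of functions
  is taken.\<close>

lemma commuting_fields_decreasing:
  assumes E: "\<And>n. E n \<in> sub_sigma_fields M" and "\<And>n. commuting_fields F (E n)"
  shows "commuting_fields F (\<Inter>n. E n)"
  unfolding commuting_fields_def
  using assms by (auto intro!: measurable_Inter_sub_sigma_fields simp: commuting_fields_def)

lemma Int_stable_UN_incseq:
  fixes E :: "nat \<Rightarrow> 'a set set"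
  assumes "\<And>n. E n \<in> sub_sigma_fields M" "incseq E"
  shows "Int_stable (\<Union>n. E n)"
proof (rule Int_stableI)
  fix A B assume "A \<in> (\<Union>n. E n)" "B \<in> (\<Union>n. E n)"
  then obtain m n where "A \<in> E m" "B \<in> E n" by auto
  then have AB: "A \<in> E (max m n)" "B \<in> E (max m n)"
    using incseqD[OF assms(2), of m "max m n"] incseqD[OF assms(2), of n "max m n"] by auto
  interpret sigma_algebra "space M" "E (max m n)"
    using assms(1) by (rule sub_sigma_fieldsD)
  show "A \<inter> B \<in> (\<Union>n. E n)" using AB by blast
qed

lemma UN_sub_sigma_fields:
  fixes E :: "nat \<Rightarrow> 'a set set"
  assumes "\<And>n. E n \<in> sub_sigma_fields M"
  shows "sigma_sets (space M) (\<Union>n. E n) \<in> sub_sigma_fields M"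
proof (rule sigma_sets_sub_sigma_fields)
  show "(\<Union>n. E n) \<subseteq> sets M" using sub_sigma_fieldsD(2)[OF assms] by auto
  show "null_sets M \<subseteq> sigma_sets (space M) (\<Union>n. E n)"
    using sub_sigma_fieldsD(3)[OF assms] by auto
qed

text \<open>For \<open>D \<in> E n\<close>, commuting makes \<open>cprob F D\<close> measurable with
  respect to \<open>F \<inter> E n\<close>. The Dynkin argument carries this to the whole join, and
  an event of the join lying in \<open>F\<close> is recovered from its conditional
  probability.\<close>

lemma sigma_sets_UN_Int:
  fixes E :: "nat \<Rightarrow> 'a set set"
  assumes E: "\<And>n. E n \<in> sub_sigma_fields M" and inc: "incseq E" and F: "F \<in> sub_sigma_fields M"
    and c: "\<And>n. commuting_fields F (E n)"
  shows "F \<inter> sigma_sets (space M) (\<Union>n. E n) = sigma_sets (space M) (\<Union>n. F \<inter> E n)"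
    (is "?L = ?R")
proof
  have FE: "F \<inter> E n \<in> sub_sigma_fields M" for n
    using E F by (intro Int_sub_sigma_fields)
  have R: "?R \<in> sub_sigma_fields M"
    using FE by (rule UN_sub_sigma_fields)
  have U: "sigma_sets (space M) (\<Union>n. E n) \<in> sub_sigma_fields M"
    using E by (rule UN_sub_sigma_fields)
  show "?R \<subseteq> ?L"
    by (rule sigma_sets_least[OF Int_sub_sigma_fields[OF F U]]) auto
  show "?L \<subseteq> ?R"
  proof
    fix A assume A: "A \<in> ?L"
    have "cprob F A \<in> borel_measurable (sigma (space M) ?R)"
    proof (rule cprob_measurable_sigma_sets[OF F R Int_stable_UN_incseq[OF E inc]])
      show "(\<Union>n. E n) \<subseteq> sets M" using sub_sigma_fieldsD(2)[OF E] by auto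
      show "A \<in> sigma_sets (space M) (\<Union>n. E n)" using A by auto
      fix D assume "D \<in> (\<Union>n. E n)"
      then obtain n where D: "D \<in> E n" by auto
      have "F \<inter> E n \<subseteq> ?R" by auto
      then show "cprob F D \<in> borel_measurable (sigma (space M) ?R)"
        using measurable_sub_sigma_field_mono[OF FE R] cprob_Int_measurable[OF F E c D] by auto
    qed
    then show "A \<in> ?R"
      using A by (intro in_sub_sigma_fieldI[OF F R]) auto
  qed
qed

text \<open>The union of an increasing sequence is an intersection-stable generator of the join, so
  the Dynkin argument takes the place of martingale convergence.\<close>

lemma commuting_fields_increasing:
  fixes E :: "nat \<Rightarrow> 'a set set"
  assumes E: "\<And>n. E n \<in> sub_sigma_fields M" and inc: "incseq E" and F: "F \<in> sub_sigma_fields M"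
    and c: "\<And>n. commuting_fields F (E n)"
  shows "commuting_fields F (sigma_sets (space M) (\<Union>n. E n))"
  unfolding commuting_fields_def
proof
  let ?U = "sigma_sets (space M) (\<Union>n. E n)"
  have U: "?U \<in> sub_sigma_fields M"
    using E by (rule UN_sub_sigma_fields)
  fix A assume A: "A \<in> ?U"
  show "cprob F A \<in> borel_measurable (sigma (space M) ?U)"
  proof (rule cprob_measurable_sigma_sets[OF F U Int_stable_UN_incseq[OF E inc] _ _ A])
    show "(\<Union>n. E n) \<subseteq> sets M" using sub_sigma_fieldsD(2)[OF E] by auto
    fix D assume "D \<in> (\<Union>n. E n)"
    then obtain n where D: "D \<in> E n" by auto
    have "E n \<subseteq> ?U" by auto
    then show "cprob F D \<in> borel_measurable (sigma (space M) ?U)"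
      using measurable_sub_sigma_field_mono[OF E U] c D unfolding commuting_fields_def by blast
  qed
qed

text \<open>Here \<open>cprob F A\<close> is measurable with respect to the trivial field, hence
  almost surely the constant \<open>P(A)\<close>; integrating it over \<open>B\<close> gives the
  product.\<close>

lemma indep_set_commuting_fields:
  assumes F: "F \<in> sub_sigma_fields M" and G: "G \<in> sub_sigma_fields M"
    and c: "commuting_fields F G" and triv: "F \<inter> G = trivial_field M"
  shows "indep_set F G"
proof (rule indep_setI)
  show ev: "F \<subseteq> events" "G \<subseteq> events" using sub_sigma_fieldsD(2) F G by blast+
  let ?T = "trivial_field M"
  fix B A assume B: "B \<in> F" and A: "A \<in> G"
  have T: "?T \<in> sub_sigma_fields M" using Int_sub_sigma_fields[OF F G] triv by simp
  have TF: "?T \<subseteq> F" using triv by auto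
  have mT: "cprob F A \<in> borel_measurable (sigma (space M) ?T)"
    using cprob_Int_measurable[OF F G c A] triv by simp
  have indep_T: "emeasure M (A \<inter> D) = emeasure M A * emeasure M D" if D: "D \<in> ?T" for D
  proof -
    have "D \<in> null_sets M \<or> (\<exists>N\<in>null_sets M. D = space M - N)"
      using D by (auto simp: trivial_field_def)
    then show ?thesis
    proof (elim disjE bexE)
      assume "D \<in> null_sets M"
      then show ?thesis using A ev null_set_Int1[of D M A] by (auto simp: null_sets_def)
    next
      fix N assume N: "N \<in> null_sets M" "D = space M - N"
      have "A \<in> events" using A ev by auto
      then have "A \<inter> D = A - N" using N(2) sets.sets_into_space by auto
      then show ?thesis
        using N \<open>A \<in> events\<close> by (simp add: emeasure_Diff_null_set emeasure_space_1)
    qed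
  qed
  have c1: "AE x in M. emeasure M A = cprob ?T A x"
  proof (rule cprob_unique[OF T])
    show "A \<in> sets M" using A ev by auto
    fix U assume U: "U \<in> ?T"
    then have "U \<in> events" using TF ev by auto
    then show "(\<integral>\<^sup>+ x. emeasure M A * indicator U x \<partial>M) = emeasure M (A \<inter> U)"
      by (simp add: nn_integral_cmult indep_T[OF U])
  qed auto
  \<comment> \<open>Being already measurable with respect to \<open>?T\<close>, the function
    \<open>cprob F A\<close> is a version of the conditional probability given \<open>?T\<close>,
    which \<open>c1\<close> identifies as a constant.\<close>
  have c2: "AE x in M. cprob F A x = cprob ?T A x"
  proof (rule cprob_unique[OF T _ mT])
    show "A \<in> sets M" using A ev by auto
    show "(\<integral>\<^sup>+ x. cprob F A x * indicator U x \<partial>M) = emeasure M (A \<inter> U)" if "U \<in> ?T" for U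
      using that TF A ev by (intro nn_integral_cprob_indicator[OF F]) auto
  qed
  have "emeasure M (A \<inter> B) = (\<integral>\<^sup>+ x. cprob F A x * indicator B x \<partial>M)"
    using A B ev by (intro nn_integral_cprob_indicator[OF F, symmetric]) auto
  also have "\<dots> = (\<integral>\<^sup>+ x. emeasure M A * indicator B x \<partial>M)"
    by (rule nn_integral_cong_AE) (use c1 c2 in eventually_elim, simp)
  also have "\<dots> = emeasure M A * emeasure M B"
    using B ev by (intro nn_integral_cmult_indicator) auto
  finally have "ennreal (prob (B \<inter> A)) = ennreal (prob B * prob A)"
    by (simp add: emeasure_eq_measure ennreal_mult'' Int_commute mult.commute)
  then show "prob (B \<inter> A) = prob B * prob A"
    by simp
qed

section \<open>Joins of independent sigma-fields\<close>

text \<open>On a rectangle \<open>U \<inter> V\<close>, conditioning on \<open>G\<close> averages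
  out \<open>U\<close> and leaves \<open>P(U)\<close> times the indicator of \<open>V\<close>; the
  rectangles generate the join.\<close>

lemma cprob_join_measurable:
  assumes F: "F \<in> sub_sigma_fields M" and G: "G \<in> sub_sigma_fields M"
    and H: "H \<in> sub_sigma_fields M" and "H \<subseteq> G"
    and indep: "indep_set F G" and A: "A \<in> sigma_join M F H"
  shows "cprob G A \<in> borel_measurable (sigma (space M) H)"
proof (rule cprob_measurable_sigma_sets[OF G H Int_stable_rectangles[OF F H]])
  have ev: "F \<subseteq> events" "G \<subseteq> events" using sub_sigma_fieldsD(2) F G by blast+
  show "{U \<inter> V |U V. U \<in> F \<and> V \<in> H} \<subseteq> events"
    using ev \<open>H \<subseteq> G\<close> by auto
  show "A \<in> sigma_sets (space M) {U \<inter> V |U V. U \<in> F \<and> V \<in> H}"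
    using A sigma_join_eq_sigma_sets_Int[OF F H] by simp
  fix D assume "D \<in> {U \<inter> V |U V. U \<in> F \<and> V \<in> H}"
  then obtain U V where D: "D = U \<inter> V" and U: "U \<in> F" and V: "V \<in> H" by auto
  have V': "(indicator V :: _ \<Rightarrow> ennreal) \<in> borel_measurable (sigma (space M) K)"
    if "V \<in> K" "K \<in> sub_sigma_fields M" for K
    using that(2,1) by (rule borel_measurable_indicator_sub_sigma_field)
  have "AE x in M. emeasure M U * indicator V x = cprob G D x"
  proof (rule cprob_unique[OF G])
    show "D \<in> events" using D U V ev \<open>H \<subseteq> G\<close> by auto
    show "(\<lambda>x. emeasure M U * indicator V x) \<in> borel_measurable (sigma (space M) G)"
      using V'[of G] V \<open>H \<subseteq> G\<close> G by auto
    fix W assume W: "W \<in> G"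
    interpret G: sigma_algebra "space M" G
      using G by (rule sub_sigma_fieldsD)
    have VW: "V \<inter> W \<in> G" using V W \<open>H \<subseteq> G\<close> by auto
    have "(\<integral>\<^sup>+x. emeasure M U * indicator V x * indicator W x \<partial>M)
        = (\<integral>\<^sup>+x. emeasure M U * indicator (V \<inter> W) x \<partial>M)"
      by (simp add: indicator_inter_arith mult.assoc)
    also have "\<dots> = emeasure M U * emeasure M (V \<inter> W)"
      using VW ev by (intro nn_integral_cmult_indicator) auto
    also have "\<dots> = emeasure M (U \<inter> (V \<inter> W))"
      using indep_setD[OF indep U VW] by (simp add: emeasure_eq_measure ennreal_mult)
    finally show "(\<integral>\<^sup>+x. emeasure M U * indicator V x * indicator W x \<partial>M) = emeasure M (D \<inter> W)"
      by (simp add: D Int_assoc)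
  qed
  then show "cprob G D \<in> borel_measurable (sigma (space M) H)"
    by (rule borel_measurable_AE_sub_sigma_field[OF H _ borel_measurable_cprob2, rotated])
       (use V'[OF V H] in simp)
qed

text \<open>An event of the join that also lies in \<open>G\<close> is almost surely its own
  conditional probability given \<open>G\<close>, which is measurable with respect to
  \<open>H\<close>. This is a modular law for independent fields.\<close>

lemma sigma_join_Int_indep:
  assumes F: "F \<in> sub_sigma_fields M" and G: "G \<in> sub_sigma_fields M"
    and H: "H \<in> sub_sigma_fields M" and "H \<subseteq> G" and "indep_set F G"
  shows "sigma_join M F H \<inter> G = H"
  using in_sub_sigma_fieldI[OF G H] cprob_join_measurable[OF assms] sigma_join_upper(2)[of H M F]
    \<open>H \<subseteq> G\<close> by blast

text \<open>
  For \<open>U \<in> F\<close>, the function \<open>cprob G (D \<inter> U)\<close> is measurable with respect to every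
  \<open>H n\<close>, hence with respect to their intersection, and these functions determine the measure
  \<open>P(D \<inter> _)\<close> on the rectangles \<open>U \<inter> V\<close>.
\<close>

lemma sigma_join_Inter_indep:
  fixes H :: "nat \<Rightarrow> 'a set set"
  assumes F: "F \<in> sub_sigma_fields M" and G: "G \<in> sub_sigma_fields M"
    and H: "\<And>n. H n \<in> sub_sigma_fields M" "\<And>n. H n \<subseteq> G" and indep: "indep_set F G"
  shows "(\<Inter>n. sigma_join M F (H n)) = sigma_join M F (\<Inter>n. H n)"
proof
  let ?b = "\<Inter>n. H n"
  let ?K = "sigma_join M F ?b"
  let ?J = "sigma_join M F G"
  show "?K \<subseteq> (\<Inter>n. sigma_join M F (H n))"
    by (intro INT_greatest sigma_join_mono) auto
  have b: "?b \<in> sub_sigma_fields M" using H(1) by (rule Inter_sub_sigma_fields)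
  have bG: "?b \<subseteq> G" using H(2) by blast
  have K: "?K \<in> sub_sigma_fields M" using F b by (rule sigma_join_sub_sigma_fields)
  have J: "?J \<in> sub_sigma_fields M" using F G by (rule sigma_join_sub_sigma_fields)
  have KJ: "?K \<subseteq> ?J" using bG by (intro sigma_join_mono) auto
  have ev: "F \<subseteq> events" "G \<subseteq> events" "?J \<subseteq> events"
    using sub_sigma_fieldsD(2) F G J by blast+
  \<comment> \<open>Through this, \<open>cprob ?K V\<close> with \<open>V \<in> G\<close> is
    measurable with respect to both \<open>?K\<close> and \<open>G\<close>.\<close>
  have comm: "commuting_fields ?K G"
  proof (rule commuting_fields_sym[OF G K])
    show "commuting_fields G ?K"
      unfolding commuting_fields_def
      using cprob_join_measurable[OF F G b bG indep]
        measurable_sub_sigma_field_mono[OF b K sigma_join_upper(2)] by blast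
  qed
  show "(\<Inter>n. sigma_join M F (H n)) \<subseteq> ?K"
  proof
    fix D assume D: "D \<in> (\<Inter>n. sigma_join M F (H n))"
    have DJ: "D \<in> ?J"
      using D sigma_join_mono[of F F "H 0" G M] H(2) by auto
    then have D': "D \<in> events" using ev by auto
    have rect: "(\<integral>\<^sup>+x. cprob ?K D x * indicator (U \<inter> V) x \<partial>M) = emeasure M (D \<inter> (U \<inter> V))"
      if U: "U \<in> F" and V: "V \<in> G" for U V
    proof -
      let ?w = "cprob G (D \<inter> U)" and ?v = "cprob ?K V"
      have U': "U \<in> events" and V': "V \<in> events" using U V ev by auto
      have DU: "D \<inter> U \<in> sigma_join M F (H n)" for n
      proof -
        interpret sigma_algebra "space M" "sigma_join M F (H n)"
          using sigma_join_sub_sigma_fields[OF F H(1)] by (rule sub_sigma_fieldsD)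
        show ?thesis using D U sigma_join_upper(1)[of F M "H n"] by auto
      qed
      have w: "?w \<in> borel_measurable (sigma (space M) ?b)"
        using cprob_join_measurable[OF F G H indep DU]
        by (intro measurable_Inter_sub_sigma_fields H)
      have wK: "?w \<in> borel_measurable (sigma (space M) ?K)"
        using measurable_sub_sigma_field_mono[OF b K sigma_join_upper(2) w] .
      have vG: "?v \<in> borel_measurable (sigma (space M) G)"
        using comm V by (auto simp: commuting_fields_def)
      have iU: "(indicator U :: _ \<Rightarrow> ennreal) \<in> borel_measurable (sigma (space M) ?K)"
        using U sigma_join_upper(1)[of F M ?b]
        by (intro borel_measurable_indicator_sub_sigma_field[OF K]) auto
      have vU: "(\<lambda>x. ?v x * indicator U x) \<in> borel_measurable (sigma (space M) ?K)"
        using borel_measurable_cprob iU by measurable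
      have cU: "(\<lambda>x. indicator U x * cprob ?K D x) \<in> borel_measurable (sigma (space M) ?K)"
        using borel_measurable_cprob iU by measurable
      \<comment> \<open>\<open>V\<close> is replaced by \<open>?v\<close>. As \<open>?v\<close> is
        measurable with respect to \<open>G\<close>, \<open>?w\<close> can be traded back for
        \<open>D \<inter> U\<close>; as it is measurable with respect to \<open>?K\<close>,
        \<open>D\<close> can be replaced by \<open>cprob ?K D\<close>. Finally \<open>?v\<close>
        returns to \<open>V\<close>.\<close>
      have "emeasure M (D \<inter> (U \<inter> V)) = (\<integral>\<^sup>+x. ?w x * indicator V x \<partial>M)"
        using nn_integral_cprob_indicator[OF G _ V, of "D \<inter> U"] D' U' by (simp add: Int_assoc)
      also have "\<dots> = (\<integral>\<^sup>+x. ?w x * ?v x \<partial>M)"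
        using nn_integral_cprob[OF K wK V'] by simp
      also have "\<dots> = (\<integral>\<^sup>+x. ?v x * indicator (D \<inter> U) x \<partial>M)"
        using nn_integral_cprob[OF G vG, of "D \<inter> U"] D' U' by (simp add: mult.commute)
      also have "\<dots> = (\<integral>\<^sup>+x. (?v x * indicator U x) * indicator D x \<partial>M)"
        by (simp add: indicator_inter_arith ac_simps)
      also have "\<dots> = (\<integral>\<^sup>+x. (?v x * indicator U x) * cprob ?K D x \<partial>M)"
        using nn_integral_cprob[OF K vU D'] by simp
      also have "\<dots> = (\<integral>\<^sup>+x. (indicator U x * cprob ?K D x) * ?v x \<partial>M)"
        by (simp add: ac_simps)
      also have "\<dots> = (\<integral>\<^sup>+x. (indicator U x * cprob ?K D x) * indicator V x \<partial>M)"
        using nn_integral_cprob[OF K cU V'] by simp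
      also have "\<dots> = (\<integral>\<^sup>+x. cprob ?K D x * indicator (U \<inter> V) x \<partial>M)"
        by (simp add: indicator_inter_arith ac_simps)
      finally show ?thesis by simp
    qed
    let ?R = "{U \<inter> V | U V. U \<in> F \<and> V \<in> G}"
    let ?N1 = "density M (cprob ?K D)" and ?N2 = "density M (indicator D)"
    have R: "?R \<subseteq> events" using ev by auto
    have e1: "emeasure ?N1 X = (\<integral>\<^sup>+x. cprob ?K D x * indicator X x \<partial>M)" if "X \<in> events" for X
      using that by (intro emeasure_density) auto
    have e2: "emeasure ?N2 X = emeasure M (D \<inter> X)" if "X \<in> events" for X
    proof -
      have "emeasure ?N2 X = (\<integral>\<^sup>+x. indicator (D \<inter> X) x \<partial>M)"
        using that D' by (simp add: emeasure_density flip: indicator_inter_arith)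
      then show ?thesis using that D' by simp
    qed
    have gen: "sigma_sets (space M) ?R = ?J"
      using sigma_join_eq_sigma_sets_Int[OF F G] by simp
    have spR: "space M \<in> ?R"
    proof -
      have "space M \<in> F" "space M \<in> G"
        using sub_sigma_fieldsD(1)[OF F] sub_sigma_fieldsD(1)[OF G]
        by (auto simp: sigma_algebra_iff2)
      then show ?thesis by blast
    qed
    have "emeasure ?N1 X = emeasure ?N2 X" if X: "X \<in> ?J" for X
    proof -
      \<comment> \<open>The rectangles generate \<open>?J\<close> rather than all events, so the
        uniqueness theorem for measures is applied to the restrictions.\<close>
      have "restr_to_subalg ?N1 (sigma (space M) ?J) = restr_to_subalg ?N2 (sigma (space M) ?J)"
      proof (rule measure_eqI_generator_eq[OF Int_stable_rectangles[OF F G], where \<Omega> = "space M" and A = "\<lambda>_. space M"])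
        have sub: "subalgebra ?N1 (sigma (space M) ?J)" "subalgebra ?N2 (sigma (space M) ?J)"
          using sub_sigma_fieldsD[OF J] by (auto simp: subalgebra_def space_measure_of_conv)
        have set: "sets (sigma (space M) ?J) = ?J" using sub_sigma_fieldsD[OF J] by auto
        show "sets (restr_to_subalg ?N1 (sigma (space M) ?J)) = sigma_sets (space M) ?R"
          "sets (restr_to_subalg ?N2 (sigma (space M) ?J)) = sigma_sets (space M) ?R"
          using sub set gen by (auto simp: sets_restr_to_subalg)
        have em: "emeasure (restr_to_subalg ?N1 (sigma (space M) ?J)) X = emeasure ?N1 X"
          "emeasure (restr_to_subalg ?N2 (sigma (space M) ?J)) X = emeasure ?N2 X"
          if "X \<in> ?R" for X
        proof -
          have "X \<in> sigma_sets (space M) ?R" using that by (rule sigma_sets.Basic)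
          then have "X \<in> sets (sigma (space M) ?J)" using set gen by simp
          then show "emeasure (restr_to_subalg ?N1 (sigma (space M) ?J)) X = emeasure ?N1 X"
            "emeasure (restr_to_subalg ?N2 (sigma (space M) ?J)) X = emeasure ?N2 X"
            using sub by (simp_all add: emeasure_restr_to_subalg)
        qed
        show "emeasure (restr_to_subalg ?N1 (sigma (space M) ?J)) X
            = emeasure (restr_to_subalg ?N2 (sigma (space M) ?J)) X" if X: "X \<in> ?R" for X
        proof -
          obtain U V where UV: "U \<in> F" "V \<in> G" "X = U \<inter> V" using X by blast
          have "X \<in> events" using X R by blast
          then show ?thesis
            using rect[OF UV(1,2)] em[OF X] e1 e2 UV(3) by simp
        qed
        show "emeasure (restr_to_subalg ?N1 (sigma (space M) ?J)) (space M) \<noteq> \<infinity>" for i :: nat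
        proof -
          obtain U V where UV: "U \<in> F" "V \<in> G" "U \<inter> V = space M" using spR by force
          have "emeasure ?N1 (space M) = emeasure M (D \<inter> space M)"
            using rect[OF UV(1,2)] e1[OF sets.top] unfolding UV(3) by simp
          then show ?thesis
            using em(1)[OF spR] by (simp add: emeasure_eq_measure)
        qed
      qed (use spR R sets.space_closed in auto)
      moreover have "subalgebra ?N1 (sigma (space M) ?J)" "subalgebra ?N2 (sigma (space M) ?J)"
        using sub_sigma_fieldsD[OF J] by (auto simp: subalgebra_def space_measure_of_conv)
      ultimately show ?thesis
        using emeasure_restr_to_subalg X sub_sigma_fieldsD(5)[OF J] by metis
    qed
    then have "AE x in M. cprob ?K D x = cprob ?J D x"
      using measurable_sub_sigma_field_mono[OF K J KJ borel_measurable_cprob] ev D'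
      by (intro cprob_unique[OF J]) (auto simp: e1 e2 subset_iff)
    then have "cprob ?J D \<in> borel_measurable (sigma (space M) ?K)"
      by (rule borel_measurable_AE_sub_sigma_field[OF K borel_measurable_cprob borel_measurable_cprob2])
    then show "D \<in> ?K"
      using in_sub_sigma_fieldI[OF J K DJ] by simp
  qed
qed

lemma indep_set_mono:
  assumes "indep_set F G" "F' \<subseteq> F" "G' \<subseteq> G"
  shows "indep_set F' G'"
  using assms unfolding indep_sets2_eq by blast

lemma indep_set_sym: "indep_set F G \<Longrightarrow> indep_set G F"
  unfolding indep_sets2_eq by (metis Int_commute mult.commute)

text \<open>Monotonicity turns the diagonal intersection into a double one, the term at
  \<open>max m n\<close> lying below the term at \<open>(m, n)\<close>. The one-sequence result then
  applies to each factor in turn.\<close>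

lemma sigma_join_Inter2_indep:
  fixes H K :: "nat \<Rightarrow> 'a set set"
  assumes F: "F \<in> sub_sigma_fields M" and G: "G \<in> sub_sigma_fields M" and indep: "indep_set F G"
    and H: "\<And>n. H n \<in> sub_sigma_fields M" "\<And>n. H n \<subseteq> F" "decseq H"
    and K: "\<And>n. K n \<in> sub_sigma_fields M" "\<And>n. K n \<subseteq> G" "decseq K"
  shows "(\<Inter>n. sigma_join M (H n) (K n)) = sigma_join M (\<Inter>n. H n) (\<Inter>n. K n)"
proof
  show "sigma_join M (\<Inter>n. H n) (\<Inter>n. K n) \<subseteq> (\<Inter>n. sigma_join M (H n) (K n))"
    by (intro INT_greatest sigma_join_mono) auto
  have K': "(\<Inter>n. K n) \<in> sub_sigma_fields M" using K(1) by (rule Inter_sub_sigma_fields)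
  have "(\<Inter>n. sigma_join M (H n) (K n)) \<subseteq> (\<Inter>m. \<Inter>n. sigma_join M (H m) (K n))"
  proof (intro INT_greatest)
    fix m n
    have "sigma_join M (H (max m n)) (K (max m n)) \<subseteq> sigma_join M (H m) (K n)"
      using decseqD[OF H(3), of m "max m n"] decseqD[OF K(3), of n "max m n"]
      by (intro sigma_join_mono) auto
    then show "(\<Inter>n. sigma_join M (H n) (K n)) \<subseteq> sigma_join M (H m) (K n)"
      by blast
  qed
  also have "\<dots> = (\<Inter>m. sigma_join M (H m) (\<Inter>n. K n))"
    using sigma_join_Inter_indep[OF H(1) G K(1,2)] indep_set_mono[OF indep H(2) order_refl]
    by auto
  also have "\<dots> = (\<Inter>m. sigma_join M (\<Inter>n. K n) (H m))"
    by (simp add: sigma_join_commute)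
  also have "\<dots> = sigma_join M (\<Inter>n. K n) (\<Inter>n. H n)"
    using K(2) by (intro sigma_join_Inter_indep[OF K' F H(1,2)] indep_set_mono[OF indep_set_sym[OF indep]]) auto
  finally show "(\<Inter>n. sigma_join M (H n) (K n)) \<subseteq> sigma_join M (\<Inter>n. H n) (\<Inter>n. K n)"
    by (simp add: sigma_join_commute)
qed

end

section \<open>Complements and induction over the monotone closure\<close>

lemma trivial_field_subset:
  assumes "E \<in> sub_sigma_fields M"
  shows "trivial_field M \<subseteq> E"
proof -
  interpret sigma_algebra "space M" E using assms by (rule sub_sigma_fieldsD)
  show ?thesis using sub_sigma_fieldsD(3)[OF assms] by (auto simp: trivial_field_def)
qed

lemma complementary_fields_sym: "complementary_fields M E F \<Longrightarrow> complementary_fields M F E"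
  by (simp add: complementary_fields_def Int_commute sigma_join_commute)

text \<open>The members of the closure satisfying \<open>P\<close> form a monotonically closed set
  containing \<open>B\<close>, so leastness makes them exhaust the closure.\<close>

lemma mono_closure_induct [consumes 2, case_names base decreasing increasing]:
  assumes B: "B \<subseteq> sub_sigma_fields M" and x: "x \<in> mono_closure M B"
    and base: "\<And>x. x \<in> B \<Longrightarrow> P x"
    and dec: "\<And>E :: nat \<Rightarrow> 'a set set. \<lbrakk>\<And>n. E n \<in> mono_closure M B; decseq E; \<And>n. P (E n)\<rbrakk> \<Longrightarrow> P (\<Inter>n. E n)"
    and inc: "\<And>E :: nat \<Rightarrow> 'a set set. \<lbrakk>\<And>n. E n \<in> mono_closure M B; incseq E; \<And>n. P (E n)\<rbrakk>
      \<Longrightarrow> P (sigma_sets (space M) (\<Union>n. E n))"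
  shows "P x"
proof -
  note mc = mono_closure_least[OF B]
  let ?Z = "{x \<in> mono_closure M B. P x}"
  have "mono_closed M ?Z"
    using mc(1) dec inc unfolding mono_closed_def by (auto simp: image_subset_iff)
  moreover have "B \<subseteq> ?Z" using mc(2) base by auto
  ultimately show ?thesis using mc(3)[of ?Z] x by auto
qed

section \<open>The algebra, and commutation and meets in its closure\<close>

locale noise_algebra = prob_space M for M :: "'a measure" +
  fixes B :: "'a set set set"
  assumes noise: "noise_type_BA M B"
begin

abbreviation "\<Lambda> \<equiv> sub_sigma_fields M"
abbreviation "cl \<equiv> mono_closure M B"
abbreviation join (infixl "\<curlyvee>" 65) where "x \<curlyvee> y \<equiv> sigma_join M x y"
abbreviation compl where "compl \<equiv> complementary_fields M"

lemma B_Lambda: "B \<subseteq> \<Lambda>"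
  using noise by (simp add: noise_type_BA_def)

lemma B_cl: "B \<subseteq> cl"
  using mono_closure_least(2)[OF B_Lambda] .

lemma cl_Lambda: "x \<in> cl \<Longrightarrow> x \<in> \<Lambda>"
  using mono_closure_least(1)[OF B_Lambda] by (auto simp: mono_closed_def)

lemma cl_Inter: "(\<And>n. E n \<in> cl) \<Longrightarrow> decseq E \<Longrightarrow> (\<Inter>n::nat. E n) \<in> cl"
  using mono_closure_least(1)[OF B_Lambda] by (auto simp: mono_closed_def image_subset_iff)

lemma cl_Union: "(\<And>n. E n \<in> cl) \<Longrightarrow> incseq E \<Longrightarrow> sigma_sets (space M) (\<Union>n::nat. E n) \<in> cl"
  using mono_closure_least(1)[OF B_Lambda] by (auto simp: mono_closed_def image_subset_iff)

lemmas cl_induct = mono_closure_induct[OF B_Lambda, consumes 1, case_names base decreasing increasing]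

lemma B_compl: "x \<in> B \<Longrightarrow> \<exists>y\<in>B. compl x y"
  using noise by (simp add: noise_type_BA_def)

lemma B_Int_join:
  assumes "x \<in> B" "y \<in> B"
  shows "x \<inter> y \<in> B" "x \<curlyvee> y \<in> B"
  using noise assms by (simp_all add: noise_type_BA_def)

text \<open>Distributivity applied to \<open>x \<inter> (y \<curlyvee> y')\<close>. Only the
  nontrivial inclusion is recorded; it is the base case for splitting in the closure.\<close>

lemma B_split:
  assumes x: "x \<in> B" and y: "y \<in> B" "y' \<in> B" and c: "compl y y'"
  shows "x \<subseteq> (x \<inter> y) \<curlyvee> (x \<inter> y')"
proof -
  have "x = x \<inter> (y \<curlyvee> y')"
    using c sub_sigma_fieldsD(2)[of x M] x B_Lambda by (auto simp: complementary_fields_def)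
  also have "\<dots> = (x \<inter> y) \<curlyvee> (x \<inter> y')"
    using noise x y unfolding noise_type_BA_def by blast
  finally show ?thesis by simp
qed

text \<open>Splitting puts \<open>x\<close> inside \<open>y' \<curlyvee> (x \<inter> y)\<close>.
  Since \<open>y'\<close> is independent of \<open>y\<close>, conditioning on \<open>y\<close>
  averages it out and leaves a function measurable with respect to
  \<open>x \<inter> y\<close>.\<close>

lemma commuting_fields_B:
  assumes x: "x \<in> B" and y: "y \<in> B"
  shows "commuting_fields y x"
  unfolding commuting_fields_def
proof
  fix A assume A: "A \<in> x"
  obtain y' where y': "y' \<in> B" "compl y y'" using B_compl y by blast
  have L: "x \<in> \<Lambda>" "y \<in> \<Lambda>" "y' \<in> \<Lambda>" using x y y'(1) B_Lambda by auto
  have L': "x \<inter> y \<in> \<Lambda>" using L by (intro Int_sub_sigma_fields)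
  have i: "indep_set y' y"
    using noise y y' unfolding noise_type_BA_def complementary_fields_def
    by (metis Int_commute)
  have "A \<in> (x \<inter> y) \<curlyvee> (x \<inter> y')" using A B_split[OF x y y'] by blast
  also have "\<dots> \<subseteq> y' \<curlyvee> (x \<inter> y)"
    by (subst sigma_join_commute) (intro sigma_join_mono, auto)
  finally have "cprob y A \<in> borel_measurable (sigma (space M) (x \<inter> y))"
    by (intro cprob_join_measurable[OF L(3,2) L' _ i]) auto
  then show "cprob y A \<in> borel_measurable (sigma (space M) x)"
    using measurable_sub_sigma_field_mono[OF L' L(1)] by blast
qed

text \<open>The field \<open>y\<close> ranges over \<open>\<Lambda>\<close>, so that the induction
  can be run first for \<open>y\<close> in \<open>B\<close> and then for \<open>y\<close> in the
  closure.\<close>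

lemma commuting_fields_cl_right:
  assumes x: "x \<in> cl" and y: "y \<in> \<Lambda>" and B: "\<And>x. x \<in> B \<Longrightarrow> commuting_fields y x"
  shows "commuting_fields y x"
  using x
proof (induction rule: cl_induct)
  case (base x)
  then show ?case by (rule B)
next
  case (decreasing E)
  then show ?case using cl_Lambda by (intro commuting_fields_decreasing) auto
next
  case (increasing E)
  then show ?case using cl_Lambda y by (intro commuting_fields_increasing) auto
qed

text \<open>One argument is extended from \<open>B\<close> to the closure, symmetry exchanges the
  roles, and then the other argument is extended.\<close>

lemma commuting_fields_cl:
  assumes "x \<in> cl" "y \<in> cl"
  shows "commuting_fields x y"
proof -
  have "commuting_fields x z" if z: "z \<in> B" for z
  proof (rule commuting_fields_sym)
    show "z \<in> \<Lambda>" "x \<in> \<Lambda>" using z assms(1) B_Lambda cl_Lambda by auto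
    then show "commuting_fields z x"
      using commuting_fields_cl_right[OF assms(1)] commuting_fields_B z by blast
  qed
  then show ?thesis
    using commuting_fields_cl_right[OF assms(2) cl_Lambda[OF assms(1)]] by blast
qed

lemma indep_set_cl:
  assumes "x \<in> cl" "y \<in> cl" "x \<inter> y = trivial_field M"
  shows "indep_set x y"
  using assms cl_Lambda commuting_fields_cl by (intro indep_set_commuting_fields) auto

lemma indep_set_compl: "x \<in> cl \<Longrightarrow> y \<in> cl \<Longrightarrow> compl x y \<Longrightarrow> indep_set x y"
  by (rule indep_set_cl) (auto simp: complementary_fields_def)

text \<open>Intersection with \<open>y\<close> passes through decreasing limits trivially, and
  through increasing joins because members of the closure commute.\<close>

lemma cl_Int_extend:
  assumes y: "y \<in> cl" and B: "\<And>x. x \<in> B \<Longrightarrow> y \<inter> x \<in> cl" and x: "x \<in> cl"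
  shows "y \<inter> x \<in> cl"
  using x
proof (induction rule: cl_induct)
  case (base x)
  then show ?case by (rule B)
next
  case (decreasing E)
  have "y \<inter> (\<Inter>n. E n) = (\<Inter>n. y \<inter> E n)" by auto
  moreover have "decseq (\<lambda>n. y \<inter> E n)"
    using decreasing(2) by (auto simp: monotone_def)
  ultimately show ?case
    using decreasing(3) by (simp only: cl_Inter)
next
  case (increasing E)
  have "y \<inter> sigma_sets (space M) (\<Union>n. E n) = sigma_sets (space M) (\<Union>n. y \<inter> E n)"
    using increasing y cl_Lambda commuting_fields_cl by (intro sigma_sets_UN_Int) auto
  moreover have "incseq (\<lambda>n. y \<inter> E n)"
    using increasing(2) by (auto simp: monotone_def)
  ultimately show ?case
    using increasing(3) by (simp only: cl_Union)
qed

lemma cl_Int: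
  assumes "x \<in> cl" "y \<in> cl"
  shows "x \<inter> y \<in> cl"
proof -
  have "z \<inter> x \<in> cl" if z: "z \<in> B" for z
  proof (rule cl_Int_extend)
    show "z \<in> cl" using z B_cl by (rule subsetD[rotated])
    show "z \<inter> w \<in> cl" if "w \<in> B" for w
      using B_Int_join(1)[OF z that] B_cl by (rule subsetD[rotated])
  qed (rule assms(1))
  then have "\<And>z. z \<in> B \<Longrightarrow> x \<inter> z \<in> cl"
    by (simp only: Int_commute)
  then show ?thesis
    using assms(2) by (rule cl_Int_extend[OF assms(1)])
qed

section \<open>Splitting along a complementary pair\<close>

text \<open>In the decreasing case the two pieces lie in the independent fields \<open>y\<close> and
  \<open>y'\<close>, so intersections pass through their join; the increasing case needs only
  monotonicity of the join.\<close>

lemma cl_split_extend: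
  assumes y: "y \<in> cl" "y' \<in> cl" "compl y y'"
    and B: "\<And>x. x \<in> B \<Longrightarrow> x \<subseteq> (x \<inter> y) \<curlyvee> (x \<inter> y')" and x: "x \<in> cl"
  shows "x \<subseteq> (x \<inter> y) \<curlyvee> (x \<inter> y')"
  using x
proof (induction rule: cl_induct)
  case (base x)
  then show ?case by (rule B)
next
  case (decreasing E)
  have "(\<Inter>n. E n) \<subseteq> (\<Inter>n. (E n \<inter> y) \<curlyvee> (E n \<inter> y'))"
    using decreasing(3) by blast
  also have "\<dots> = (\<Inter>n. E n \<inter> y) \<curlyvee> (\<Inter>n. E n \<inter> y')"
    by (rule sigma_join_Inter2_indep[OF _ _ indep_set_compl[OF y]])
       (use y decreasing(1,2) in \<open>auto simp: monotone_def intro!: cl_Lambda cl_Int\<close>)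
  finally show ?case by simp
next
  case (increasing E)
  let ?S = "sigma_sets (space M) (\<Union>n. E n)"
  have S: "?S \<in> cl" using increasing(1,2) by (rule cl_Union)
  have "E n \<subseteq> (?S \<inter> y) \<curlyvee> (?S \<inter> y')" for n
  proof -
    have "(E n \<inter> y) \<curlyvee> (E n \<inter> y') \<subseteq> (?S \<inter> y) \<curlyvee> (?S \<inter> y')"
      by (intro sigma_join_mono) auto
    then show ?thesis using increasing(3) by blast
  qed
  then show ?case
    using S y cl_Int cl_Lambda
    by (intro sigma_sets_least[OF sigma_join_sub_sigma_fields]) auto
qed

text \<open>
  For \<open>x \<in> B\<close> with complement \<open>x'\<close>, splitting \<open>y\<close> and \<open>y'\<close> along \<open>x, x'\<close> shows that
  \<open>x'\<close> and the right-hand side generate everything, so independence of \<open>x\<close> and \<open>x'\<close>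
  leaves no room between the right-hand side and \<open>x\<close>.
\<close>

lemma cl_split:
  assumes x: "x \<in> cl" and y: "y \<in> cl" "y' \<in> cl" "compl y y'"
  shows "x \<subseteq> (x \<inter> y) \<curlyvee> (x \<inter> y')"
proof (rule cl_split_extend[OF y _ x])
  fix x assume x: "x \<in> B"
  then obtain x' where x': "x' \<in> B" "compl x x'" using B_compl by blast
  have cl: "x \<in> cl" "x' \<in> cl" using x x' B_cl by auto
  let ?a = "(x \<inter> y) \<curlyvee> (x \<inter> y')"
  have a: "?a \<in> \<Lambda>"
    using cl y cl_Int cl_Lambda by (intro sigma_join_sub_sigma_fields) auto
  have ax: "?a \<subseteq> x"
    using cl cl_Lambda by (intro sigma_join_least) auto
  have xa: "x' \<curlyvee> ?a \<in> \<Lambda>"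
    using cl_Lambda[OF cl(2)] a by (rule sigma_join_sub_sigma_fields)
  have sub: "z \<subseteq> x' \<curlyvee> ?a" if "z \<in> cl" "x \<inter> z \<subseteq> ?a" for z
  proof -
    have "z \<subseteq> (z \<inter> x) \<curlyvee> (z \<inter> x')"
    proof (rule cl_split_extend[OF cl x'(2) _ that(1)])
      show "w \<subseteq> (w \<inter> x) \<curlyvee> (w \<inter> x')" if "w \<in> B" for w
        using that x x' by (rule B_split)
    qed
    also have "\<dots> \<subseteq> ?a \<curlyvee> x'"
      using that(2) by (intro sigma_join_mono) auto
    finally show ?thesis by (simp add: sigma_join_commute)
  qed
  have "sets M = y \<curlyvee> y'" using y by (simp add: complementary_fields_def)
  also have "\<dots> \<subseteq> x' \<curlyvee> ?a"
  proof (rule sigma_join_least[OF xa])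
    show "y \<subseteq> x' \<curlyvee> ?a"
      using y(1) sigma_join_upper(1) by (rule sub)
    show "y' \<subseteq> x' \<curlyvee> ?a"
      using y(2) sigma_join_upper(2) by (rule sub)
  qed
  finally have "x \<subseteq> (x' \<curlyvee> ?a) \<inter> x"
    using sub_sigma_fieldsD(2)[OF cl_Lambda[OF cl(1)]] by blast
  also have "\<dots> = ?a"
    using cl_Lambda[OF cl(2)] cl_Lambda[OF cl(1)] a ax indep_set_sym[OF indep_set_compl[OF cl x'(2)]]
    by (rule sigma_join_Int_indep)
  finally show "x \<subseteq> ?a" .
qed

section \<open>Joins, De Morgan law, uniqueness of complements and distributivity\<close>

text \<open>After splitting \<open>x\<close>, the piece inside \<open>y\<close> is absorbed. The
  join with \<open>y\<close> thereby becomes a join of independent fields, to which the results on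
  such joins apply.\<close>

lemma join_compl:
  assumes x: "x \<in> cl" and y: "y \<in> cl" "y' \<in> cl" "compl y y'"
  shows "x \<curlyvee> y = y \<curlyvee> (x \<inter> y')"
proof
  have L: "x \<in> \<Lambda>" "y \<in> \<Lambda>" "y' \<in> \<Lambda>" "x \<inter> y' \<in> \<Lambda>"
    using x y cl_Lambda cl_Int by auto
  have "(x \<inter> y) \<curlyvee> (x \<inter> y') \<subseteq> y \<curlyvee> (x \<inter> y')"
    by (rule sigma_join_mono) auto
  then show "x \<curlyvee> y \<subseteq> y \<curlyvee> (x \<inter> y')"
    using cl_split[OF assms] sigma_join_upper(1)[of y M]
    by (intro sigma_join_least sigma_join_sub_sigma_fields L) auto
  show "y \<curlyvee> (x \<inter> y') \<subseteq> x \<curlyvee> y"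
    by (subst sigma_join_commute) (rule sigma_join_mono, auto)
qed

lemma join_compl_Int:
  assumes x: "x \<in> cl" and y: "y \<in> cl" "y' \<in> cl" "compl y y'"
  shows "(x \<curlyvee> y) \<inter> y' = x \<inter> y'"
  unfolding join_compl[OF assms]
  using x y indep_set_compl cl_Lambda cl_Int by (intro sigma_join_Int_indep) auto

text \<open>In the decreasing case \<open>E n\<close> is replaced by \<open>E n \<inter> y'\<close>,
  which is independent of \<open>y\<close>, so the join with \<open>y\<close> is continuous along
  the sequence.\<close>

lemma cl_join_extend:
  assumes y: "y \<in> cl" "y' \<in> cl" "compl y y'"
    and B: "\<And>x. x \<in> B \<Longrightarrow> x \<curlyvee> y \<in> cl" and x: "x \<in> cl"
  shows "x \<curlyvee> y \<in> cl"
  using x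
proof (induction rule: cl_induct)
  case (base x)
  then show ?case by (rule B)
next
  case (decreasing E)
  have E: "(\<Inter>n. E n) \<in> cl" using decreasing(1,2) by (rule cl_Inter)
  have "(\<Inter>n. E n) \<curlyvee> y = y \<curlyvee> (\<Inter>n. E n \<inter> y')"
    using join_compl[OF E y] by simp
  also have "\<dots> = (\<Inter>n. y \<curlyvee> (E n \<inter> y'))"
    using y decreasing(1)
    by (intro sigma_join_Inter_indep[symmetric, of y y'] indep_set_compl)
       (auto intro!: cl_Lambda cl_Int)
  also have "\<dots> = (\<Inter>n. E n \<curlyvee> y)"
    using join_compl[OF decreasing(1) y] by simp
  moreover have "decseq (\<lambda>n. E n \<curlyvee> y)"
    using decreasing(2) by (simp add: monotone_def sigma_join_mono)
  ultimately show ?case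
    using decreasing(3) by (simp only: cl_Inter)
next
  case (increasing E)
  let ?S = "sigma_sets (space M) (\<Union>n. E n)"
  have S: "?S \<in> cl" using increasing(1,2) by (rule cl_Union)
  have *: "sigma_sets (space M) (\<Union>n. E n \<curlyvee> y) \<in> cl"
    using increasing(2,3) by (intro cl_Union) (simp_all add: monotone_def sigma_join_mono)
  have "E n \<subseteq> sigma_sets (space M) (\<Union>n. E n \<curlyvee> y)" "y \<subseteq> sigma_sets (space M) (\<Union>n. E n \<curlyvee> y)" for n
    using sigma_join_upper(1)[of "E n" M y] sigma_join_upper(2)[of y M "E n"] by blast+
  then have "?S \<curlyvee> y \<subseteq> sigma_sets (space M) (\<Union>n. E n \<curlyvee> y)"
    using cl_Lambda[OF *] by (intro sigma_join_least sigma_sets_least) auto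
  moreover have "E n \<curlyvee> y \<subseteq> ?S \<curlyvee> y" for n
    by (rule sigma_join_mono) auto
  then have "sigma_sets (space M) (\<Union>n. E n \<curlyvee> y) \<subseteq> ?S \<curlyvee> y"
    using S y cl_Lambda
    by (intro sigma_sets_least[OF sigma_join_sub_sigma_fields]) auto
  ultimately have "?S \<curlyvee> y = sigma_sets (space M) (\<Union>n. E n \<curlyvee> y)"
    by (rule equalityI)
  then show ?case using * by simp
qed

text \<open>Two passes: first the complemented factor is in \<open>B\<close> and the other one is
  extended to the closure; after commuting, this is the base case for the given
  \<open>y\<close>.\<close>

lemma cl_join:
  assumes x: "x \<in> cl" and y: "y \<in> cl" "y' \<in> cl" "compl y y'"
  shows "x \<curlyvee> y \<in> cl"
proof (rule cl_join_extend[OF y _ x])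
  fix x assume x: "x \<in> B"
  then obtain x' where x': "x' \<in> B" "compl x x'" using B_compl by blast
  have xx': "x \<in> cl" "x' \<in> cl" using x x' B_cl by auto
  have "z \<curlyvee> x \<in> cl" if "z \<in> B" for z
    using B_Int_join(2)[OF that x] B_cl by (rule subsetD[rotated])
  then have "y \<curlyvee> x \<in> cl"
    using y(1) by (rule cl_join_extend[OF xx' x'(2)])
  then show "x \<curlyvee> y \<in> cl" by (simp add: sigma_join_commute)
qed

text \<open>De Morgan law. Triviality of the meet follows as \<open>x\<close> meets
  \<open>x' \<curlyvee> y'\<close> only in \<open>x \<inter> y'\<close>; for generation,
  \<open>x\<close> is split along \<open>y\<close> and \<open>y'\<close>, and both pieces lie in the
  join.\<close>

lemma compl_Int:
  assumes x: "x \<in> cl" "x' \<in> cl" "compl x x'" and y: "y \<in> cl" "y' \<in> cl" "compl y y'"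
  shows "compl (x \<inter> y) (x' \<curlyvee> y')"
  unfolding complementary_fields_def
proof
  have x'y': "x' \<curlyvee> y' \<in> cl"
    using x(2) y(2,1) complementary_fields_sym[OF y(3)] by (rule cl_join)
  have L: "x \<inter> y \<in> \<Lambda>" "x' \<curlyvee> y' \<in> \<Lambda>" "x \<inter> y \<curlyvee> (x' \<curlyvee> y') \<in> \<Lambda>"
    using cl_Lambda[OF cl_Int[OF x(1) y(1)]] cl_Lambda[OF x'y'] sigma_join_sub_sigma_fields by blast+
  have "(y' \<curlyvee> x') \<inter> x = y' \<inter> x"
    using y(2) x(2,1) complementary_fields_sym[OF x(3)] by (rule join_compl_Int)
  then have "x \<inter> y \<inter> (x' \<curlyvee> y') \<subseteq> y \<inter> y'"
    by (auto simp: sigma_join_commute)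
  then show "x \<inter> y \<inter> (x' \<curlyvee> y') = trivial_field M"
    using trivial_field_subset[OF Int_sub_sigma_fields[OF L(1,2)]] y
    by (auto simp: complementary_fields_def)
  let ?J = "x \<inter> y \<curlyvee> (x' \<curlyvee> y')"
  have up: "x \<inter> y \<subseteq> ?J" "x' \<curlyvee> y' \<subseteq> ?J"
    by (rule sigma_join_upper)+
  then have up': "x' \<subseteq> ?J" "y' \<subseteq> ?J"
    using sigma_join_upper(1)[of x' M y'] sigma_join_upper(2)[of y' M x'] by blast+
  have "(x \<inter> y) \<curlyvee> (x \<inter> y') \<subseteq> ?J"
    using up up' by (intro sigma_join_least[OF L(3)]) auto
  then have "x \<curlyvee> x' \<subseteq> ?J"
    using cl_split[OF x(1) y] up' by (intro sigma_join_least[OF L(3)]) auto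
  then show "?J = sets M"
    using x sub_sigma_fieldsD(2)[OF L(3)] by (auto simp: complementary_fields_def)
qed

text \<open>Splitting \<open>z\<close> along \<open>x\<close> and \<open>y\<close> leaves only
  \<open>z \<inter> y\<close>, the other piece being trivial. Exchanging \<open>y\<close> and
  \<open>z\<close> gives equality.\<close>

lemma compl_unique:
  assumes x: "x \<in> cl" and y: "y \<in> cl" "compl x y" and z: "z \<in> cl" "compl x z"
  shows "z \<subseteq> y"
proof -
  have "z \<inter> x \<subseteq> z \<inter> y"
    using z trivial_field_subset[of "z \<inter> y" M] y cl_Lambda cl_Int
    by (auto simp: complementary_fields_def Int_commute)
  then have "(z \<inter> x) \<curlyvee> (z \<inter> y) \<subseteq> z \<inter> y"
    using y z cl_Int cl_Lambda by (intro sigma_join_least) auto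
  then show ?thesis
    using cl_split[OF z(1) x y] by blast
qed

text \<open>The left-hand side is split along \<open>y\<close> and \<open>y'\<close>; the piece in
  \<open>y'\<close> lies in \<open>z\<close>, because
  \<open>(z \<curlyvee> y) \<inter> y' = z \<inter> y'\<close>.\<close>

lemma distrib:
  assumes x: "x \<in> cl" and y: "y \<in> cl" "y' \<in> cl" "compl y y'" and z: "z \<in> cl"
  shows "x \<inter> (y \<curlyvee> z) = (x \<inter> y) \<curlyvee> (x \<inter> z)"
proof
  have "z \<curlyvee> y \<in> cl" using z y by (rule cl_join)
  then have w: "x \<inter> (y \<curlyvee> z) \<in> cl"
    using x cl_Int by (simp add: sigma_join_commute)
  have "x \<inter> (y \<curlyvee> z) \<subseteq> (x \<inter> (y \<curlyvee> z) \<inter> y) \<curlyvee> (x \<inter> (y \<curlyvee> z) \<inter> y')"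
    using w y by (rule cl_split)
  also have "\<dots> \<subseteq> (x \<inter> y) \<curlyvee> (x \<inter> z)"
    using join_compl_Int[OF z y] by (intro sigma_join_mono) (auto simp: sigma_join_commute)
  finally show "x \<inter> (y \<curlyvee> z) \<subseteq> (x \<inter> y) \<curlyvee> (x \<inter> z)" .
  show "(x \<inter> y) \<curlyvee> (x \<inter> z) \<subseteq> x \<inter> (y \<curlyvee> z)"
    using sigma_join_upper(1)[of y M z] sigma_join_upper(2)[of z M y] w
    by (intro sigma_join_least cl_Lambda) auto
qed

section \<open>Complemented elements of the closure as the noise-type completion\<close>

definition complemented :: "'a set set set" where
  "complemented = {x \<in> cl. \<exists>y\<in>cl. compl x y}"

lemma complementedE:
  assumes "x \<in> complemented"
  obtains x' where "x \<in> cl" "x' \<in> cl" "compl x x'"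
  using assms by (auto simp: complemented_def)

text \<open>Joins are reduced to meets by applying the De Morgan law to the complements.\<close>

lemma complemented_Int_join:
  assumes "x \<in> complemented" "y \<in> complemented"
  shows "x \<inter> y \<in> complemented" "x \<curlyvee> y \<in> complemented"
proof -
  obtain x' where x: "x \<in> cl" "x' \<in> cl" "compl x x'" using assms(1) by (rule complementedE)
  obtain y' where y: "y \<in> cl" "y' \<in> cl" "compl y y'" using assms(2) by (rule complementedE)
  note x' = x(2,1) complementary_fields_sym[OF x(3)]
  note y' = y(2,1) complementary_fields_sym[OF y(3)]
  show "x \<inter> y \<in> complemented"
    using compl_Int[OF x y] cl_Int[OF x(1) y(1)] cl_join[OF x(2) y'] by (auto simp: complemented_def)
  show "x \<curlyvee> y \<in> complemented"
    using complementary_fields_sym[OF compl_Int[OF x' y']] cl_Int[OF x(2) y(2)] cl_join[OF x(1) y]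
    by (auto simp: complemented_def)
qed

lemma B_complemented: "B \<subseteq> complemented"
  using B_cl B_compl unfolding complemented_def by blast

lemma noise_type_BA_complemented: "noise_type_BA M complemented"
  unfolding noise_type_BA_def
proof (intro conjI ballI impI)
  show "complemented \<subseteq> \<Lambda>"
    using cl_Lambda by (auto simp: complemented_def)
  show "trivial_field M \<in> complemented" "sets M \<in> complemented"
    using noise B_complemented by (auto simp: noise_type_BA_def)
next
  fix x y assume "x \<in> complemented" "y \<in> complemented"
  then show "x \<inter> y \<in> complemented" "x \<curlyvee> y \<in> complemented"
    by (rule complemented_Int_join)+
next
  fix x y z assume "x \<in> complemented" "y \<in> complemented" "z \<in> complemented"
  then show "x \<inter> (y \<curlyvee> z) = (x \<inter> y) \<curlyvee> (x \<inter> z)"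
    using distrib unfolding complemented_def by blast
next
  fix x assume "x \<in> complemented"
  then show "\<exists>y\<in>complemented. compl x y"
    using complementary_fields_sym unfolding complemented_def by blast
next
  fix x y assume "x \<in> complemented" "y \<in> complemented" "x \<inter> y = trivial_field M"
  then show "indep_set x y"
    by (auto simp: complemented_def intro: indep_set_cl)
qed

text \<open>A competitor \<open>C\<close> lies in the closure by monotone density, and the
  complements that it contains then lie in the closure too.\<close>

lemma noise_completion_eq: "noise_completion M B = complemented"
  unfolding noise_completion_def
proof (rule Greatest_equality)
  have "mono_dense M B complemented"
    using mono_closure_least(3)[OF B_Lambda] by (auto simp: mono_dense_def complemented_def)
  then show "noise_type_BA M complemented \<and> B \<subseteq> complemented \<and> mono_dense M B complemented"
    using noise_type_BA_complemented B_complemented by simp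
next
  fix C assume C: "noise_type_BA M C \<and> B \<subseteq> C \<and> mono_dense M B C"
  then have "C \<subseteq> cl"
    using mono_closure_least(1,2)[OF B_Lambda] by (auto simp: mono_dense_def)
  moreover have "\<exists>y\<in>C. compl x y" if "x \<in> C" for x
    using C that by (simp add: noise_type_BA_def)
  ultimately show "C \<subseteq> complemented"
    unfolding complemented_def by blast
qed

end

theorem theorem2:
  fixes M :: "'a measure" and B :: "'a set set set" and E :: "'a set set"
  assumes "prob_space M"
    and "separable_L2 M"
    and "noise_type_BA M B"
    and "E \<in> sub_sigma_fields M"
  shows "(E \<in> noise_completion M B \<longleftrightarrow>
            E \<in> mono_closure M B \<and> (\<exists>E'\<in>mono_closure M B. complementary_fields M E E')) \<and>
         (E \<in> mono_closure M B \<and> (\<exists>E'\<in>mono_closure M B. complementary_fields M E E') \<longrightarrow>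
            (\<exists>!E'. E' \<in> mono_closure M B \<and> complementary_fields M E E'))"
proof -
  interpret noise_algebra M B
    using assms by (simp add: noise_algebra_def noise_algebra_axioms_def)
  have "E' = E''" if "E \<in> cl" "E' \<in> cl" "compl E E'" "E'' \<in> cl" "compl E E''" for E' E''
    using compl_unique that by (intro equalityI)
  then show ?thesis
    by (auto simp: noise_completion_eq complemented_def)
qed

end
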